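(* Let $F$ be a formula in CNF, possibly containing the equality predicate $\approx$. If a clause $C$ is equality-blocked in $F$, then $C$ is redundant with respect to $F$, i.e., $F \setminus \{C\}$ and $F \cup \{C\}$ are satisfiability equivalent.
   Context: First-order logic with equality: in every interpretation $\approx$ is interpreted as the identity relation on the domain; $s \not\approx t$ abbreviates $\neg(s \approx t)$. A literal is an atom or a negated atom; $\bar L$ is the complement of $L$. Clauses are disjunctions (multisets) of literals with implicitly universally quantified variables, distinct clauses being variable disjoint; a CNF formula is a finite set of clauses. A clause is valid if it is true in every interpretation. Flattening a literal $L(t_1,\dots,t_n)$ (a literal with some predicate symbol and polarity applied to terms $t_i$) in a clause $L(t_1,\dots,t_n) \lor C'$ yields $\bigvee_{i=1}^n x_i \not\approx t_i \lor L(x_1,\dots,x_n) \lor C'$ with fresh variables $x_i$. Flat $L$-resolvent: let $C = L \lor C'$ and $D = N_1 \lor \dots \lor N_l \lor D'$, $l>0$, where $L, \bar N_1,\dots,\bar N_l$ have the same predicate symbol and polarity; let $C^-$, $D^-$ be obtained by flattening $L$ in $C$ and $N_1,\dots,N_l$ in $D$, with flattened literals $L^-, N_1^-,\dots,N_l^-$; then $(C^- \setminus \{L^-\})\sigma \lor (D^- \setminus \{N_1^-,\dots,N_l^-\})\sigma$, with $\sigma$ a most general unifier of $L^-, \bar N_1^-, \dots, \bar N_l^-$, is a flat $L$-resolvent of $C$ and $D$. A clause $C$ is equality-blocked by $L \in C$ in $F$ if the predicate symbol of $L$ is not $\approx$ and every flat $L$-resolvent of $C$ with a clause in $F \setminus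 \{C\}$ is valid; $C$ is equality-blocked in $F$ if it is equality-blocked by some literal of $C$. Two formulas are satisfiability equivalent if both are satisfiable or both are unsatisfiable. *)

theory Defs
  imports "HOL-Library.Multiset" "HOL-Library.Infinite_Typeclass"
begin

text \<open>
  Symbols carry no arity of their own: a symbol applied to argument lists of different lengths
  counts as several unrelated symbols. Signatures with fixed arities are the special case in which
  every symbol is used with one length only.
\<close>

datatype ('f, vars_tm: 'v) tm = Var 'v | Fun 'f "('f, 'v) tm list"

datatype ('f, 'p, vars_atom: 'v) atom =
    Eq "('f, 'v) tm" "('f, 'v) tm"
  | Pred 'p "('f, 'v) tm list"

datatype ('f, 'p, vars_lit: 'v) lit =
    is_pos: Pos (atm: "('f, 'p, 'v) atom")
  | Neg (atm: "('f, 'p, 'v) atom")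

type_synonym ('f, 'p, 'v) clause = "('f, 'p, 'v) lit multiset"

primrec compl :: "('f, 'p, 'v) lit \<Rightarrow> ('f, 'p, 'v) lit" where
  "compl (Pos A) = Neg A"
| "compl (Neg A) = Pos A"

definition vars_clause :: "('f, 'p, 'v) clause \<Rightarrow> 'v set" where
  "vars_clause C = (\<Union>L \<in> set_mset C. vars_lit L)"

definition cnf_formula :: "('f, 'p, 'v) clause set \<Rightarrow> bool" where
  "cnf_formula F \<longleftrightarrow>
     finite F \<and> pairwise (\<lambda>C D. vars_clause C \<inter> vars_clause D = {}) F"

datatype 'p psym = EqSym | PredSym 'p nat

primrec atom_sym :: "('f, 'p, 'v) atom \<Rightarrow> 'p psym" where
  "atom_sym (Eq s t) = EqSym"
| "atom_sym (Pred p ts) = PredSym p (length ts)"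

definition same_sym_pol :: "('f, 'p, 'v) lit \<Rightarrow> ('f, 'p, 'v) lit \<Rightarrow> bool" where
  "same_sym_pol L M \<longleftrightarrow> atom_sym (atm L) = atom_sym (atm M) \<and> is_pos L = is_pos M"


subsection \<open>Semantics\<close>

text \<open>
  The domain of an interpretation is a nonempty subset of the type \<open>'d\<close>. As HOL cannot quantify
  over types inside a formula, validity and satisfiability carry \<open>'d\<close> as a parameter. Whenever
  \<open>'d\<close> is infinite they coincide with the usual notions (Loewenheim-Skolem, formulas being finite);
  domains that are proper subsets of \<open>'d\<close> are needed for that, since with equality a formula may
  have finite models only.
\<close>

record ('f, 'p, 'd) interp =
  domain :: "'d set"
  ifun :: "'f \<Rightarrow> 'd list \<Rightarrow> 'd"
  ipred :: "'p \<Rightarrow> 'd list \<Rightarrow> bool"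

definition is_interp :: "('f, 'p, 'd) interp \<Rightarrow> bool" where
  "is_interp I \<longleftrightarrow>
     domain I \<noteq> {} \<and> (\<forall>f ds. set ds \<subseteq> domain I \<longrightarrow> ifun I f ds \<in> domain I)"

primrec eval_tm :: "('f, 'p, 'd) interp \<Rightarrow> ('v \<Rightarrow> 'd) \<Rightarrow> ('f, 'v) tm \<Rightarrow> 'd" where
  "eval_tm I \<beta> (Var x) = \<beta> x"
| "eval_tm I \<beta> (Fun f ts) = ifun I f (map (eval_tm I \<beta>) ts)"

primrec true_atom :: "('f, 'p, 'd) interp \<Rightarrow> ('v \<Rightarrow> 'd) \<Rightarrow> ('f, 'p, 'v) atom \<Rightarrow> bool" where
  "true_atom I \<beta> (Eq s t) \<longleftrightarrow> eval_tm I \<beta> s = eval_tm I \<beta> t"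
| "true_atom I \<beta> (Pred p ts) \<longleftrightarrow> ipred I p (map (eval_tm I \<beta>) ts)"

primrec true_lit :: "('f, 'p, 'd) interp \<Rightarrow> ('v \<Rightarrow> 'd) \<Rightarrow> ('f, 'p, 'v) lit \<Rightarrow> bool" where
  "true_lit I \<beta> (Pos A) \<longleftrightarrow> true_atom I \<beta> A"
| "true_lit I \<beta> (Neg A) \<longleftrightarrow> \<not> true_atom I \<beta> A"

definition true_clause :: "('f, 'p, 'd) interp \<Rightarrow> ('f, 'p, 'v) clause \<Rightarrow> bool" where
  "true_clause I C \<longleftrightarrow> (\<forall>\<beta>. range \<beta> \<subseteq> domain I \<longrightarrow> (\<exists>L \<in># C. true_lit I \<beta> L))"

definition valid :: "'d itself \<Rightarrow> ('f, 'p, 'v) clause \<Rightarrow> bool" where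
  "valid _ C \<longleftrightarrow> (\<forall>I :: ('f, 'p, 'd) interp. is_interp I \<longrightarrow> true_clause I C)"

definition satisfiable :: "'d itself \<Rightarrow> ('f, 'p, 'v) clause set \<Rightarrow> bool" where
  "satisfiable _ F \<longleftrightarrow>
     (\<exists>I :: ('f, 'p, 'd) interp. is_interp I \<and> (\<forall>C \<in> F. true_clause I C))"

definition sat_equivalent ::
  "'d itself \<Rightarrow> ('f, 'p, 'v) clause set \<Rightarrow> ('f, 'p, 'v) clause set \<Rightarrow> bool" where
  "sat_equivalent d F G \<longleftrightarrow>
     (satisfiable d F \<and> satisfiable d G) \<or> (\<not> satisfiable d F \<and> \<not> satisfiable d G)"

definition redundant :: "'d itself \<Rightarrow> ('f, 'p, 'v) clause \<Rightarrow> ('f, 'p, 'v) clause set \<Rightarrow> bool" where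
  "redundant d C F \<longleftrightarrow> sat_equivalent d (F - {C}) (F \<union> {C})"


subsection \<open>Substitutions and most general unifiers\<close>

type_synonym ('f, 'v) subst = "'v \<Rightarrow> ('f, 'v) tm"

primrec subst_tm :: "('f, 'v) subst \<Rightarrow> ('f, 'v) tm \<Rightarrow> ('f, 'v) tm" where
  "subst_tm \<sigma> (Var x) = \<sigma> x"
| "subst_tm \<sigma> (Fun f ts) = Fun f (map (subst_tm \<sigma>) ts)"

primrec subst_atom :: "('f, 'v) subst \<Rightarrow> ('f, 'p, 'v) atom \<Rightarrow> ('f, 'p, 'v) atom" where
  "subst_atom \<sigma> (Eq s t) = Eq (subst_tm \<sigma> s) (subst_tm \<sigma> t)"
| "subst_atom \<sigma> (Pred p ts) = Pred p (map (subst_tm \<sigma>) ts)"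

primrec subst_lit :: "('f, 'v) subst \<Rightarrow> ('f, 'p, 'v) lit \<Rightarrow> ('f, 'p, 'v) lit" where
  "subst_lit \<sigma> (Pos A) = Pos (subst_atom \<sigma> A)"
| "subst_lit \<sigma> (Neg A) = Neg (subst_atom \<sigma> A)"

definition subst_clause :: "('f, 'v) subst \<Rightarrow> ('f, 'p, 'v) clause \<Rightarrow> ('f, 'p, 'v) clause" where
  "subst_clause \<sigma> C = image_mset (subst_lit \<sigma>) C"

definition is_unifier :: "('f, 'v) subst \<Rightarrow> ('f, 'p, 'v) lit set \<Rightarrow> bool" where
  "is_unifier \<sigma> S \<longleftrightarrow> (\<forall>L \<in> S. \<forall>M \<in> S. subst_lit \<sigma> L = subst_lit \<sigma> M)"

definition is_mgu :: "('f, 'v) subst \<Rightarrow> ('f, 'p, 'v) lit set \<Rightarrow> bool" where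
  "is_mgu \<sigma> S \<longleftrightarrow>
     is_unifier \<sigma> S \<and> (\<forall>\<tau>. is_unifier \<tau> S \<longrightarrow> (\<exists>\<delta>. \<forall>x. \<tau> x = subst_tm \<delta> (\<sigma> x)))"


subsection \<open>Flattening and flat resolvents\<close>

primrec atom_args :: "('f, 'p, 'v) atom \<Rightarrow> ('f, 'v) tm list" where
  "atom_args (Eq s t) = [s, t]"
| "atom_args (Pred p ts) = ts"

primrec flat_atom :: "'v list \<Rightarrow> ('f, 'p, 'v) atom \<Rightarrow> ('f, 'p, 'v) atom" where
  "flat_atom xs (Eq s t) = Eq (Var (xs ! 0)) (Var (xs ! 1))"
| "flat_atom xs (Pred p ts) = Pred p (map Var xs)"

primrec flat_lit :: "'v list \<Rightarrow> ('f, 'p, 'v) lit \<Rightarrow> ('f, 'p, 'v) lit" where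
  "flat_lit xs (Pos A) = Pos (flat_atom xs A)"
| "flat_lit xs (Neg A) = Neg (flat_atom xs A)"

text \<open>
  Flattening one occurrence of \<open>L\<close> in \<open>C\<close> with the variables \<open>xs\<close>; that these are distinct, fresh
  and of the right number is demanded where flattening is used.
\<close>

definition flatten ::
  "'v list \<Rightarrow> ('f, 'p, 'v) lit \<Rightarrow> ('f, 'p, 'v) clause \<Rightarrow> ('f, 'p, 'v) clause" where
  "flatten xs L C =
     mset (map2 (\<lambda>x t. Neg (Eq (Var x) t)) xs (atom_args (atm L)))
     + {#flat_lit xs L#} + (C - {#L#})"

text \<open>
  \<open>flat_resolvent L C D R\<close>: \<open>R\<close> is a flat \<open>L\<close>-resolvent of \<open>C\<close> and \<open>D\<close>. The list \<open>Ns\<close> selects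
  literal occurrences of \<open>D\<close>, and \<open>yss\<close> holds one list of fresh variables for each of them.
  That \<open>C\<close> and \<open>D\<close> share no variables is not demanded here but is part of \<^const>\<open>cnf_formula\<close>.
\<close>

inductive flat_resolvent ::
  "('f, 'p, 'v) lit \<Rightarrow> ('f, 'p, 'v) clause \<Rightarrow> ('f, 'p, 'v) clause \<Rightarrow> ('f, 'p, 'v) clause \<Rightarrow> bool"
where
  "\<lbrakk> L \<in># C; Ns \<noteq> []; mset Ns \<subseteq># D;
     \<forall>N \<in> set Ns. same_sym_pol L (compl N);
     length xs = length (atom_args (atm L));
     list_all2 (\<lambda>ys N. length ys = length (atom_args (atm N))) yss Ns;
     distinct (xs @ concat yss);
     set (xs @ concat yss) \<inter> (vars_clause C \<union> vars_clause D) = {};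
     Lm = flat_lit xs L;
     Nms = map2 flat_lit yss Ns;
     Cm = flatten xs L C;
     Dm = fold (\<lambda>(ys, N). flatten ys N) (zip yss Ns) D;
     is_mgu \<sigma> ({Lm} \<union> compl ` set Nms) \<rbrakk>
   \<Longrightarrow> flat_resolvent L C D (subst_clause \<sigma> (Cm - {#Lm#}) + subst_clause \<sigma> (Dm - mset Nms))"

definition eq_blocked_by ::
  "'d itself \<Rightarrow> ('f, 'p, 'v) lit \<Rightarrow> ('f, 'p, 'v) clause \<Rightarrow> ('f, 'p, 'v) clause set \<Rightarrow> bool" where
  "eq_blocked_by d L C F \<longleftrightarrow>
     L \<in># C \<and> atom_sym (atm L) \<noteq> EqSym \<and>
     (\<forall>D \<in> F - {C}. \<forall>R. flat_resolvent L C D R \<longrightarrow> valid d R)"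

definition eq_blocked ::
  "'d itself \<Rightarrow> ('f, 'p, 'v) clause \<Rightarrow> ('f, 'p, 'v) clause set \<Rightarrow> bool" where
  "eq_blocked d C F \<longleftrightarrow> (\<exists>L \<in># C. eq_blocked_by d L C F)"

end

theory Submission imports Defs begin

text \<open>
  Let \<open>I\<close> be a model of \<open>F - {C}\<close>, and let \<open>C\<close> be equality-blocked by \<open>L\<close>, with predicate symbol
  \<open>p\<close>. If \<open>C\<close> is false in \<open>I\<close> under \<open>\<beta>\<close>, then changing the truth value of \<open>p\<close> at the single tuple
  \<open>ds\<close> denoted by the arguments of \<open>L\<close> keeps all clauses of \<open>F - {C}\<close> true: if \<open>D\<close> became false under
  \<open>\<gamma>\<close>, resolve \<open>C\<close> with \<open>D\<close> upon all literals of \<open>D\<close> whose value changed; the resolvent is false in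
  \<open>I\<close> when the variables of \<open>C\<close> are read by \<open>\<beta>\<close>, those of \<open>D\<close> by \<open>\<gamma>\<close>, and the fresh ones as \<open>ds\<close>.

  Such a change may falsify other instances of \<open>C\<close>, so it has to be iterated. All changes go in the
  same direction, and an instance of a clause depends on finitely many tuples only, so Zorn's lemma
  yields a maximal set of changed tuples that preserves \<open>F - {C}\<close>; by maximality \<open>C\<close> is true.
\<close>

subsection \<open>Evaluation\<close>

lemma finite_vars_tm: "finite (vars_tm t)"
  by (induction t) auto

lemma finite_vars_clause:
  fixes C :: "('f, 'p, 'v) clause"
  shows "finite (vars_clause C)"
proof -
  have "finite (vars_atom A)" for A :: "('f, 'p, 'v) atom"
    by (cases A) (auto simp: finite_vars_tm)
  then have "finite (vars_lit L)" for L :: "('f, 'p, 'v) lit"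
    by (cases L) auto
  then show ?thesis
    by (simp add: vars_clause_def)
qed

lemma eval_tm_subst: "eval_tm I \<beta> (subst_tm \<sigma> t) = eval_tm I (\<lambda>x. eval_tm I \<beta> (\<sigma> x)) t"
  by (induction t) (auto cong: map_cong simp: comp_def)

lemma true_lit_subst:
  fixes L :: "('f, 'p, 'v) lit"
  shows "true_lit I \<beta> (subst_lit \<sigma> L) \<longleftrightarrow> true_lit I (\<lambda>x. eval_tm I \<beta> (\<sigma> x)) L"
proof -
  have "true_atom I \<beta> (subst_atom \<sigma> A) \<longleftrightarrow> true_atom I (\<lambda>x. eval_tm I \<beta> (\<sigma> x)) A"
    for A :: "('f, 'p, 'v) atom"
    by (cases A) (auto simp: eval_tm_subst comp_def)
  then show ?thesis
    by (cases L) auto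
qed

lemma eval_tm_cong: "(\<And>x. x \<in> vars_tm t \<Longrightarrow> \<beta> x = \<gamma> x) \<Longrightarrow> eval_tm I \<beta> t = eval_tm I \<gamma> t"
proof (induction t)
  case (Fun f ts)
  then have "map (eval_tm I \<beta>) ts = map (eval_tm I \<gamma>) ts"
    by (intro map_cong) auto
  then show ?case
    by (simp only: eval_tm.simps)
qed auto

lemma true_lit_cong:
  fixes L :: "('f, 'p, 'v) lit"
  assumes "\<And>x. x \<in> vars_lit L \<Longrightarrow> \<beta> x = \<gamma> x"
  shows "true_lit I \<beta> L \<longleftrightarrow> true_lit I \<gamma> L"
proof -
  have atom: "true_atom I \<beta> A \<longleftrightarrow> true_atom I \<gamma> A"
    if "\<And>x. x \<in> vars_atom A \<Longrightarrow> \<beta> x = \<gamma> x" for A :: "('f, 'p, 'v) atom"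
  proof (cases A)
    case (Eq s t)
    then show ?thesis
      using that eval_tm_cong[of s \<beta> \<gamma> I] eval_tm_cong[of t \<beta> \<gamma> I] by auto
  next
    case (Pred p ts)
    then have "map (eval_tm I \<beta>) ts = map (eval_tm I \<gamma>) ts"
      using that by (intro map_cong eval_tm_cong) auto
    then show ?thesis
      using Pred by (simp only: true_atom.simps)
  qed
  show ?thesis
    using assms by (cases L) (auto simp: atom)
qed

lemma eval_atom_args_cong:
  assumes "\<And>x. x \<in> vars_lit L \<Longrightarrow> \<beta> x = \<gamma> x"
  shows "map (eval_tm I \<beta>) (atom_args (atm L)) = map (eval_tm I \<gamma>) (atom_args (atm L))"
proof (intro map_cong refl eval_tm_cong)
  fix t x assume "t \<in> set (atom_args (atm L))" "x \<in> vars_tm t"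
  then have "x \<in> vars_lit L"
    by (cases L; cases "atm L") auto
  then show "\<beta> x = \<gamma> x" by (rule assms)
qed


subsection \<open>Flattening\<close>

text \<open>The disequations contributed by flattening, kept apart from the flattened literal
  because resolution removes the latter and leaves them behind.\<close>

abbreviation flat_eqs :: "'v list \<Rightarrow> ('f, 'p, 'v) lit \<Rightarrow> ('f, 'p, 'v) clause" where
  "flat_eqs xs L \<equiv> mset (map2 (\<lambda>x t. Neg (Eq (Var x) t)) xs (atom_args (atm L)))"

lemma flat_eqs_false:
  assumes "map \<beta> xs = map (eval_tm I \<beta>) (atom_args (atm L))" and "M \<in># flat_eqs xs L"
  shows "\<not> true_lit I \<beta> M"
proof -
  from assms(2) obtain i where "i < length xs" "i < length (atom_args (atm L))"
    and M: "M = Neg (Eq (Var (xs ! i)) (atom_args (atm L) ! i))"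
    by (auto simp: set_zip)
  with assms(1) have "\<beta> (xs ! i) = eval_tm I \<beta> (atom_args (atm L) ! i)"
    by (metis nth_map)
  with M show ?thesis by simp
qed

text \<open>\<open>A\<close> collects what earlier rounds produced. Each \<open>N\<close> is taken
  out of \<open>X\<close>, so literals introduced on the way survive even if one of them equals a
  later \<open>N\<close>.\<close>

lemma fold_flatten:
  assumes "length yss = length Ns" and "mset Ns \<subseteq># X"
  shows "fold (\<lambda>(ys, N). flatten ys N) (zip yss Ns) (A + X) =
    A + sum_list (map2 flat_eqs yss Ns) + mset (map2 flat_lit yss Ns) + (X - mset Ns)"
  using assms
proof (induction yss Ns arbitrary: A X rule: list_induct2)
  case Nil
  then show ?case by simp
next
  case (Cons ys yss N Ns)
  from Cons.prems have N: "N \<in># X" and Ns: "mset Ns \<subseteq># X - {#N#}"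
    by (auto simp: insert_subset_eq_iff)
  from N have "flatten ys N (A + X) = (A + flat_eqs ys N + {#flat_lit ys N#}) + (X - {#N#})"
    by (simp add: flatten_def add_ac)
  then have "fold (\<lambda>(ys, N). flatten ys N) (zip (ys # yss) (N # Ns)) (A + X) =
      fold (\<lambda>(ys, N). flatten ys N) (zip yss Ns)
        ((A + flat_eqs ys N + {#flat_lit ys N#}) + (X - {#N#}))"
    by (simp only: zip_Cons_Cons fold_simps prod.case)
  also have "\<dots> = (A + flat_eqs ys N + {#flat_lit ys N#}) + sum_list (map2 flat_eqs yss Ns) +
      mset (map2 flat_lit yss Ns) + (X - {#N#} - mset Ns)"
    by (rule Cons.IH[OF Ns])
  finally show ?case
    by (simp add: add_ac)
qed

section \<open>Fresh variables and unification of flattened literals\<close>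

lemma ex_fresh_lists:
  assumes "finite (V :: 'v :: infinite set)"
  shows "\<exists>xss. length xss = k \<and> (\<forall>xs \<in> set xss. length xs = n) \<and>
    distinct (concat xss) \<and> set (concat xss) \<inter> V = {}"
proof (induction k)
  case 0
  show ?case by (intro exI[of _ "[]"]) simp
next
  case (Suc k)
  then obtain xss where xss: "length xss = k" "\<forall>xs \<in> set xss. length xs = n"
    "distinct (concat xss)" "set (concat xss) \<inter> V = {}"
    by blast
  have "infinite (UNIV - (V \<union> set (concat xss)))"
    using assms by (intro Diff_infinite_finite infinite_UNIV) auto
  then obtain X where X: "X \<subseteq> UNIV - (V \<union> set (concat xss))" "finite X" "card X = n"
    by (metis infinite_arbitrarily_large)
  then obtain xs where "set xs = X" "distinct xs"
    using finite_distinct_list by blast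
  with X xss show ?case
    by (intro exI[of _ "xs # xss"]) (auto simp: distinct_card)
qed

text \<open>Distinctness of \<open>concat yss\<close> makes the lists repetition-free and pairwise
  disjoint, so sending each of them entrywise to \<open>xs\<close> is consistent.\<close>

lemma ex_renaming:
  assumes "\<forall>ys \<in> set yss. length ys = length xs" and "distinct (concat yss)"
  shows "\<exists>\<rho>. (\<forall>ys \<in> set yss. map \<rho> ys = xs) \<and> (\<forall>v. v \<notin> set (concat yss) \<longrightarrow> \<rho> v = v)"
  using assms
proof (induction yss)
  case Nil
  show ?case by (intro exI[of _ "\<lambda>v. v"]) simp
next
  case (Cons ys yss)
  then obtain \<rho> where \<rho>: "\<forall>zs \<in> set yss. map \<rho> zs = xs" "\<forall>v. v \<notin> set (concat yss) \<longrightarrow> \<rho> v = v"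
    by auto
  let ?m = "map_of (zip ys xs)"
  let ?\<rho> = "\<lambda>v. if v \<in> set ys then the (?m v) else \<rho> v"
  have "map ?\<rho> ys = xs"
    using Cons.prems by (intro nth_equalityI) (auto simp: map_of_zip_nth)
  moreover have "map ?\<rho> zs = xs" if "zs \<in> set yss" for zs
  proof -
    have "set zs \<inter> set ys = {}"
      using Cons.prems that by auto
    then have "map ?\<rho> zs = map \<rho> zs"
      by (intro map_cong) auto
    with \<rho> that show ?thesis by simp
  qed
  ultimately show ?case
    using \<rho> by (intro exI[of _ ?\<rho>]) auto
qed

text \<open>Turns the unification problem for \<open>L\<close> and the complements of the selected
  literals into one for copies of \<open>L\<close> with different variables.\<close>

lemma compl_flat_lit:
  assumes "same_sym_pol L (compl N)" and "atm L = Pred p ts"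
  shows "compl (flat_lit ys N) = flat_lit ys L"
  using assms by (cases L; cases N; cases "atm N") (auto simp: same_sym_pol_def)

text \<open>Flattened literals have only variables as arguments, so unifying them means identifying
  variables entry by entry; sending every list in \<open>Z\<close> to \<open>xs\<close> does this
  and nothing more.\<close>

lemma is_mgu_renaming:
  assumes "\<forall>zs \<in> Z. map \<rho> zs = xs" and "\<forall>v. v \<notin> \<Union> (set ` Z) \<longrightarrow> \<rho> v = v"
    and "set xs \<inter> \<Union> (set ` Z) = {}" and L: "atm L = Pred p ts"
  shows "is_mgu (\<lambda>v. Var (\<rho> v)) (insert (flat_lit xs L) ((\<lambda>zs. flat_lit zs L) ` Z))"
proof -
  have xs: "map \<rho> xs = xs"
    using assms(2,3) by (intro map_idI) blast
  have subst: "subst_lit \<tau> (flat_lit zs L) = subst_lit \<tau>' (flat_lit zs' L) \<longleftrightarrow> map \<tau> zs = map \<tau>' zs'"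
    for \<tau> \<tau>' zs zs'
    using L by (cases L) (auto simp: comp_def)
  have "subst_lit (\<lambda>v. Var (\<rho> v)) M = subst_lit (\<lambda>v. Var (\<rho> v)) (flat_lit xs L)"
    if M: "M \<in> insert (flat_lit xs L) ((\<lambda>zs. flat_lit zs L) ` Z)" for M
  proof -
    from M obtain zs where M_eq: "M = flat_lit zs L" and "zs = xs \<or> zs \<in> Z"
      by blast
    with assms(1) xs have "map \<rho> zs = map \<rho> xs" by auto
    then have "map Var (map \<rho> zs) = map Var (map \<rho> xs)" by (rule arg_cong)
    then have "map (\<lambda>v. Var (\<rho> v)) zs = map (\<lambda>v. Var (\<rho> v)) xs"
      by (simp only: map_map comp_def)
    then show ?thesis by (simp only: M_eq subst)
  qed
  then have "is_unifier (\<lambda>v. Var (\<rho> v)) (insert (flat_lit xs L) ((\<lambda>zs. flat_lit zs L) ` Z))"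
    unfolding is_unifier_def by metis
  \<comment> \<open>The factor is \<open>\<tau>\<close> itself: a unifier agrees entrywise on each
    \<open>zs\<close> and on \<open>xs\<close>, hence \<open>\<tau> (\<rho> x) = \<tau> x\<close>;
    outside these lists \<open>\<rho>\<close> is the identity.\<close>
  moreover have "\<exists>\<delta>. \<forall>x. \<tau> x = subst_tm \<delta> (Var (\<rho> x))"
    if "is_unifier \<tau> (insert (flat_lit xs L) ((\<lambda>zs. flat_lit zs L) ` Z))" for \<tau>
  proof (intro exI[of _ \<tau>] allI)
    fix x
    show "\<tau> x = subst_tm \<tau> (Var (\<rho> x))"
    proof (cases "x \<in> \<Union> (set ` Z)")
      case True
      then obtain zs where zs: "zs \<in> Z" "x \<in> set zs" by blast
      with that have "subst_lit \<tau> (flat_lit zs L) = subst_lit \<tau> (flat_lit xs L)"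
        unfolding is_unifier_def by blast
      then have "map \<tau> zs = map \<tau> xs"
        by (simp only: subst)
      also have "xs = map \<rho> zs"
        using assms(1) zs by simp
      finally show ?thesis
        using zs by simp
    qed (use assms(2) in auto)
  qed
  ultimately show ?thesis
    unfolding is_mgu_def by blast
qed

text \<open>Blockedness concerns all flat resolvents, but one of this explicit form suffices: its
  unifier fixes \<open>xs\<close> and the variables of both clauses, so assignments are easily
  carried through it.\<close>

lemma flat_resolvent_renaming:
  fixes C D :: "('f, 'p, 'v :: infinite) clause"
  assumes "L \<in># C" and L: "atm L = Pred p ts" and "Ns \<noteq> []" and Ns: "mset Ns \<subseteq># D"
    and sym: "\<forall>N \<in> set Ns. same_sym_pol L (compl N)"
  obtains xs yss \<rho> where
    "length xs = length ts" "distinct xs"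
    "length yss = length Ns" "\<forall>ys \<in> set yss. map \<rho> ys = xs"
    "\<And>v. v \<in> set xs \<union> vars_clause C \<union> vars_clause D \<Longrightarrow> \<rho> v = v"
    "set xs \<inter> (vars_clause C \<union> vars_clause D) = {}"
    "flat_resolvent L C D
      (subst_clause (\<lambda>v. Var (\<rho> v)) (flat_eqs xs L + (C - {#L#})) +
       subst_clause (\<lambda>v. Var (\<rho> v)) (sum_list (map2 flat_eqs yss Ns) + (D - mset Ns)))"
proof -
  let ?V = "vars_clause C \<union> vars_clause D"
  have "finite ?V"
    by (simp add: finite_vars_clause)
  \<comment> \<open>One list more than \<open>Ns\<close> has entries: the first is for
    \<open>L\<close>.\<close>
  from ex_fresh_lists[OF this, of "Suc (length Ns)" "length ts"] obtain xss
    where xss: "length xss = Suc (length Ns)" "\<forall>xs \<in> set xss. length xs = length ts"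
      "distinct (concat xss)" "set (concat xss) \<inter> ?V = {}"
    by blast
  from xss(1) obtain xs yss where "xss = xs # yss"
    by (cases xss) auto
  with xss have yss: "length yss = length Ns" "\<forall>ys \<in> set yss. length ys = length xs"
    and xs: "length xs = length ts"
    and dist: "distinct (xs @ concat yss)" and fresh: "set (xs @ concat yss) \<inter> ?V = {}"
    by auto
  from ex_renaming[OF yss(2)] dist obtain \<rho>
    where \<rho>: "\<forall>ys \<in> set yss. map \<rho> ys = xs" "\<forall>v. v \<notin> set (concat yss) \<longrightarrow> \<rho> v = v"
    by auto
  let ?\<sigma> = "\<lambda>v. Var (\<rho> v)"
  have len: "length (atom_args (atm N)) = length ts" if "N \<in> set Ns" for N
    using sym that L by (cases N; cases "atm N") (auto simp: same_sym_pol_def)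
  have "compl ` set (map2 flat_lit yss Ns) = (\<lambda>ys. flat_lit ys L) ` set yss"
  proof -
    have "map compl (map2 flat_lit yss Ns) = map (\<lambda>ys. flat_lit ys L) yss"
      using yss(1) sym L by (intro nth_equalityI) (auto intro!: compl_flat_lit)
    then show ?thesis
      by (metis list.set_map)
  qed
  moreover have "is_mgu ?\<sigma> (insert (flat_lit xs L) ((\<lambda>ys. flat_lit ys L) ` set yss))"
    using \<rho> dist L by (intro is_mgu_renaming) auto
  ultimately have mgu: "is_mgu ?\<sigma> ({flat_lit xs L} \<union> compl ` set (map2 flat_lit yss Ns))"
    by simp
  have "flat_resolvent L C D
      (subst_clause ?\<sigma> (flatten xs L C - {#flat_lit xs L#}) +
       subst_clause ?\<sigma> (fold (\<lambda>(ys, N). flatten ys N) (zip yss Ns) D - mset (map2 flat_lit yss Ns)))"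
  proof (rule flat_resolvent.intros[OF assms(1,3) Ns sym _ _ dist fresh refl refl refl refl mgu])
    show "length xs = length (atom_args (atm L))"
      using xs L by simp
    show "list_all2 (\<lambda>ys N. length ys = length (atom_args (atm N))) yss Ns"
      using yss xs len by (simp add: list_all2_conv_all_nth)
  qed
  moreover have "flatten xs L C - {#flat_lit xs L#} = flat_eqs xs L + (C - {#L#})"
    by (simp add: flatten_def)
  moreover have "fold (\<lambda>(ys, N). flatten ys N) (zip yss Ns) D - mset (map2 flat_lit yss Ns) =
      sum_list (map2 flat_eqs yss Ns) + (D - mset Ns)"
    using fold_flatten[OF yss(1) Ns, of "{#}"] by simp
  ultimately have res: "flat_resolvent L C D
      (subst_clause ?\<sigma> (flat_eqs xs L + (C - {#L#})) +
       subst_clause ?\<sigma> (sum_list (map2 flat_eqs yss Ns) + (D - mset Ns)))"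
    by simp
  have \<rho>_id: "\<rho> v = v" if "v \<in> set xs \<union> vars_clause C \<union> vars_clause D" for v
  proof -
    from that dist fresh have "v \<notin> set (concat yss)" by auto
    with \<rho>(2) show ?thesis by blast
  qed
  have "distinct xs" "set xs \<inter> ?V = {}"
    using dist fresh by auto
  from that[OF xs this(1) yss(1) \<rho>(1) \<rho>_id this(2) res] show thesis .
qed


subsection \<open>Changing a predicate at a set of tuples\<close>

text \<open>The single value \<open>b\<close> for all tuples encodes that changes go in one
  direction; successive changes then just enlarge \<open>S\<close>, and inclusion orders
  them.\<close>

definition override :: "('f, 'p, 'd) interp \<Rightarrow> 'p \<Rightarrow> bool \<Rightarrow> 'd list set \<Rightarrow> ('f, 'p, 'd) interp" where
  "override I p b S = I\<lparr>ipred := \<lambda>q ds. if q = p \<and> ds \<in> S then b else ipred I q ds\<rparr>"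

lemma domain_override [simp]: "domain (override I p b S) = domain I"
  by (simp add: override_def)

lemma is_interp_override [simp]: "is_interp (override I p b S) \<longleftrightarrow> is_interp I"
  by (simp add: is_interp_def override_def)

lemma eval_tm_override [simp]: "eval_tm (override I p b S) \<beta> = eval_tm I \<beta>"
proof
  show "eval_tm (override I p b S) \<beta> t = eval_tm I \<beta> t" for t
    by (induction t) (auto simp: override_def cong: map_cong)
qed

lemma ipred_override [simp]:
  "ipred (override I p b S) q ds \<longleftrightarrow> (if q = p \<and> ds \<in> S then b else ipred I q ds)"
  by (simp add: override_def)

lemma override_empty [simp]: "override I p b {} = I"
  by (simp add: override_def)

lemma override_insert: "override (override I p b S) p b {ds} = override I p b (insert ds S)"
  by (auto simp: override_def fun_eq_iff)

lemma true_lit_override_cong: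
  assumes "\<And>ts. atm L = Pred p ts \<Longrightarrow> map (eval_tm I \<beta>) ts \<in> S \<longleftrightarrow> map (eval_tm I \<beta>) ts \<in> T"
  shows "true_lit (override I p b S) \<beta> L \<longleftrightarrow> true_lit (override I p b T) \<beta> L"
  using assms by (cases L; cases "atm L") auto

text \<open>The changed tuple receives the value \<open>b\<close>, so only a literal of the opposite
  polarity at that tuple can turn false.\<close>

lemma falsified_by_override:
  assumes "true_lit I \<gamma> N" and "\<not> true_lit (override I p b {ds}) \<gamma> N"
  shows "\<exists>us. atm N = Pred p us \<and> map (eval_tm I \<gamma>) us = ds \<and> is_pos N \<noteq> b"
  using assms by (cases N; cases "atm N") (auto split: if_splits)

text \<open>An instance of \<open>D\<close> involves finitely many tuples; those lying in the union
  of the chain already lie in one member, whose interpretation agrees with that of the union on this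
  instance.\<close>

lemma true_clause_override_Union:
  fixes I :: "('f, 'p, 'd) interp" and D :: "('f, 'p, 'v) clause"
  assumes "subset.chain UNIV \<S>" and "\<S> \<noteq> {}"
    and "\<And>S. S \<in> \<S> \<Longrightarrow> true_clause (override I p b S) D"
  shows "true_clause (override I p b (\<Union> \<S>)) D"
  unfolding true_clause_def
proof (intro allI impI)
  fix \<beta> :: "'v \<Rightarrow> 'd"
  assume \<beta>: "range \<beta> \<subseteq> domain (override I p b (\<Union> \<S>))"
  \<comment> \<open>Argument lists of equations are collected too; this is harmless, since
    \<open>?T\<close> only has to be finite and cover the predicate literals.\<close>
  let ?T = "(\<lambda>M. map (eval_tm I \<beta>) (atom_args (atm M))) ` set_mset D"
  have "finite (?T \<inter> \<Union> \<S>)" by simp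
  then obtain S where S: "S \<in> \<S>" "?T \<inter> \<Union> \<S> \<subseteq> S"
    using finite_subset_Union_chain[of "?T \<inter> \<Union> \<S>" \<S> UNIV] assms(1,2) by blast
  from assms(3)[OF S(1)] \<beta> obtain M where M: "M \<in># D" "true_lit (override I p b S) \<beta> M"
    unfolding true_clause_def domain_override by blast
  have "true_lit (override I p b (\<Union> \<S>)) \<beta> M \<longleftrightarrow> true_lit (override I p b S) \<beta> M"
  proof (rule true_lit_override_cong)
    fix ts assume "atm M = Pred p ts"
    with M(1) have "map (eval_tm I \<beta>) ts \<in> ?T" by force
    with S show "map (eval_tm I \<beta>) ts \<in> \<Union> \<S> \<longleftrightarrow> map (eval_tm I \<beta>) ts \<in> S" by blast
  qed
  with M show "\<exists>M \<in># D. true_lit (override I p b (\<Union> \<S>)) \<beta> M" by blast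
qed

text \<open>The single change, stated for an arbitrary \<open>I\<close> so that it also applies to
  an interpretation already changed at other tuples.\<close>

lemma true_clause_override_blocked:
  fixes C D :: "('f, 'p, 'v :: infinite) clause" and I :: "('f, 'p, 'd) interp"
  assumes I: "is_interp I" and "true_clause I D"
    and disj: "vars_clause C \<inter> vars_clause D = {}"
    and valid: "\<And>R. flat_resolvent L C D R \<Longrightarrow> valid TYPE('d) R"
    and "L \<in># C" and L: "atm L = Pred p ts"
    and \<beta>: "range \<beta> \<subseteq> domain I" and C_false: "\<And>M. M \<in># C \<Longrightarrow> \<not> true_lit I \<beta> M"
  shows "true_clause (override I p (is_pos L) {map (eval_tm I \<beta>) ts}) D"
proof (rule ccontr)
  let ?ds = "map (eval_tm I \<beta>) ts"
  let ?J = "override I p (is_pos L) {?ds}"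
  assume "\<not> true_clause ?J D"
  then obtain \<gamma> where \<gamma>: "range \<gamma> \<subseteq> domain I" and D_false: "\<And>M. M \<in># D \<Longrightarrow> \<not> true_lit ?J \<gamma> M"
    unfolding true_clause_def domain_override by blast
  \<comment> \<open>Every occurrence in \<open>D\<close> that is true in \<open>I\<close> is
    resolved upon, so \<open>D - mset Ns\<close> keeps only false literals.\<close>
  obtain Ns where Ns: "mset Ns = filter_mset (true_lit I \<gamma>) D"
    using ex_mset by blast
  have Ns_iff: "N \<in> set Ns \<longleftrightarrow> N \<in># D \<and> true_lit I \<gamma> N" for N
    using arg_cong[OF Ns, of set_mset] by auto
  obtain N where "N \<in># D" "true_lit I \<gamma> N"
    using \<open>true_clause I D\<close> \<gamma> unfolding true_clause_def by blast
  then have "Ns \<noteq> []"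
    using Ns_iff by force
  have flipped: "\<exists>us. atm N = Pred p us \<and> map (eval_tm I \<gamma>) us = ?ds \<and> is_pos N \<noteq> is_pos L"
    if "N \<in> set Ns" for N
    using that Ns_iff D_false by (intro falsified_by_override) auto
  have sym: "\<forall>N \<in> set Ns. same_sym_pol L (compl N)"
  proof
    fix N assume "N \<in> set Ns"
    with flipped obtain us where us: "atm N = Pred p us" "map (eval_tm I \<gamma>) us = ?ds"
      "is_pos N \<noteq> is_pos L" by blast
    \<comment> \<open>Predicate symbols include the number of arguments; it agrees because both
      argument lists evaluate to the same tuple.\<close>
    then have "length us = length ts" by (metis length_map)
    with us L show "same_sym_pol L (compl N)"
      by (cases N) (auto simp: same_sym_pol_def)
  qed
  have sub: "mset Ns \<subseteq># D"
    by (simp add: Ns)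
  have rest: "D - mset Ns = filter_mset (\<lambda>M. \<not> true_lit I \<gamma> M) D"
    unfolding Ns by (intro multiset_eqI) simp
  obtain xs yss \<rho> where xs: "length xs = length ts" "distinct xs"
    and yss: "length yss = length Ns" "\<forall>ys \<in> set yss. map \<rho> ys = xs"
    and \<rho>: "\<And>v. v \<in> set xs \<union> vars_clause C \<union> vars_clause D \<Longrightarrow> \<rho> v = v"
    and fresh: "set xs \<inter> (vars_clause C \<union> vars_clause D) = {}"
    and res: "flat_resolvent L C D
      (subst_clause (\<lambda>v. Var (\<rho> v)) (flat_eqs xs L + (C - {#L#})) +
       subst_clause (\<lambda>v. Var (\<rho> v)) (sum_list (map2 flat_eqs yss Ns) + (D - mset Ns)))"
    (is "flat_resolvent _ _ _ ?R")
    by (fact flat_resolvent_renaming[OF \<open>L \<in># C\<close> L \<open>Ns \<noteq> []\<close> sub sym])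
  \<comment> \<open>Freshness of \<open>xs\<close> and disjointness of \<open>C\<close> and
    \<open>D\<close> keep the three readings from conflicting. \<open>\<gamma>\<close> is also the
    default for all other variables; those in \<open>yss\<close> are read through
    \<open>\<rho>\<close>.\<close>
  define \<delta> where "\<delta> v = (if v \<in> set xs then the (map_of (zip xs ?ds) v)
    else if v \<in> vars_clause C then \<beta> v else \<gamma> v)" for v
  have eval_dom: "eval_tm I \<beta> t \<in> domain I" for t
    using I \<beta> by (induction t) (auto simp: is_interp_def image_subset_iff)
  have \<delta>_xs: "map \<delta> xs = ?ds"
    using xs by (intro nth_equalityI) (auto simp: \<delta>_def map_of_zip_nth)
  have "\<delta> v \<in> domain I" for v
  proof (cases "v \<in> set xs")
    case True
    then have "\<delta> v \<in> set ?ds" by (metis \<delta>_xs image_eqI list.set_map)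
    then show ?thesis using eval_dom by auto
  qed (use \<beta> \<gamma> in \<open>auto simp: \<delta>_def\<close>)
  then have "range \<delta> \<subseteq> domain I" by blast
  then obtain M where M: "M \<in># ?R" "true_lit I \<delta> M"
    using valid[OF res] I unfolding valid_def true_clause_def by blast
  \<comment> \<open>By \<open>true_lit_subst\<close>, a literal of the resolvent under
    \<open>\<delta>\<close> has the truth value of its unsubstituted form under
    \<open>\<delta>'\<close>.\<close>
  define \<delta>' where "\<delta>' v = \<delta> (\<rho> v)" for v
  have \<delta>'_C: "\<delta>' v = \<beta> v" if "v \<in> vars_clause C" for v
    using that \<rho> fresh by (auto simp: \<delta>'_def \<delta>_def)
  have \<delta>'_D: "\<delta>' v = \<gamma> v" if "v \<in> vars_clause D" for v
    using that \<rho> fresh disj by (auto simp: \<delta>'_def \<delta>_def)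
  have \<delta>'_xs: "map \<delta>' xs = ?ds"
    unfolding \<delta>_xs[symmetric] using \<rho> by (auto simp: \<delta>'_def)
  have \<delta>'_ys: "map \<delta>' ys = ?ds" if "ys \<in> set yss" for ys
  proof -
    have "map \<delta>' ys = map \<delta> (map \<rho> ys)" by (simp add: \<delta>'_def)
    also have "\<dots> = ?ds" using yss that \<delta>_xs by simp
    finally show ?thesis .
  qed
  have lit_C: "v \<in> vars_clause C" if "M \<in># C" "v \<in> vars_lit M" for M v
    using that by (auto simp: vars_clause_def)
  have lit_D: "v \<in> vars_clause D" if "M \<in># D" "v \<in> vars_lit M" for M v
    using that by (auto simp: vars_clause_def)
  from M(1) obtain K where M_eq: "M = subst_lit (\<lambda>v. Var (\<rho> v)) K"
    and "K \<in># flat_eqs xs L + (C - {#L#}) + (sum_list (map2 flat_eqs yss Ns) + (D - mset Ns))"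
    unfolding subst_clause_def image_mset_union[symmetric] set_image_mset by (elim imageE)
  then consider (eqC) "K \<in># flat_eqs xs L" | (C) "K \<in># C - {#L#}"
    | (eqD) "K \<in># sum_list (map2 flat_eqs yss Ns)" | (D) "K \<in># D - mset Ns"
    by (auto simp only: union_iff)
  moreover have K: "true_lit I \<delta>' K"
    using M(2) by (simp add: M_eq true_lit_subst \<delta>'_def[abs_def])
  ultimately show False
  proof cases
    case eqC
    have "map \<delta>' xs = map (eval_tm I \<beta>) (atom_args (atm L))"
      using \<delta>'_xs L by simp
    also have "\<dots> = map (eval_tm I \<delta>') (atom_args (atm L))"
      using \<delta>'_C lit_C[OF \<open>L \<in># C\<close>] by (intro eval_atom_args_cong) simp
    finally show False
      using flat_eqs_false eqC K by blast
  next
    case C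
    then have "K \<in># C" by (rule in_diffD)
    with C_false K true_lit_cong[of K \<delta>' \<beta> I] \<delta>'_C lit_C show False by blast
  next
    case eqD
    then obtain E where E: "E \<in> set (map2 flat_eqs yss Ns)" "K \<in># E"
      unfolding set_mset_sum_list by blast
    from E(1) obtain ys N where "(ys, N) \<in> set (zip yss Ns)" "E = flat_eqs ys N"
      by auto
    with E(2) have N: "ys \<in> set yss" "N \<in> set Ns" "K \<in># flat_eqs ys N"
      by (auto dest: set_zip_leftD set_zip_rightD)
    \<comment> \<open>Since \<open>N\<close> changed its value, its arguments denote
      \<open>?ds\<close>, which is also the reading of \<open>ys\<close>; hence all disequations
      from flattening \<open>N\<close> are false.\<close>
    from flipped[OF N(2)] have "map \<delta>' ys = map (eval_tm I \<gamma>) (atom_args (atm N))"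
      using \<delta>'_ys[OF N(1)] by auto
    also have "\<dots> = map (eval_tm I \<delta>') (atom_args (atm N))"
      using \<delta>'_D lit_D[of N] N(2) Ns_iff by (intro eval_atom_args_cong) simp
    finally show False
      using flat_eqs_false N(3) K by blast
  next
    case D
    then have "K \<in># D" "\<not> true_lit I \<gamma> K"
      by (auto simp: rest)
    with K true_lit_cong[of K \<delta>' \<gamma> I] \<delta>'_D lit_D show False by blast
  qed
qed

section \<open>Satisfiability equivalence from a maximal set of changed tuples\<close>

theorem theorem4:
  fixes F :: "('f, 'p, 'v :: infinite) clause set" and C :: "('f, 'p, 'v) clause"
  assumes "cnf_formula (insert C F)"
    and "eq_blocked TYPE('d) C F"
  shows "redundant TYPE('d) C F"
proof -
  from assms(2) obtain L where L: "L \<in># C" "atom_sym (atm L) \<noteq> EqSym"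
    and valid: "\<And>D R. D \<in> F - {C} \<Longrightarrow> flat_resolvent L C D R \<Longrightarrow> valid TYPE('d) R"
    by (auto simp: eq_blocked_def eq_blocked_by_def)
  from L(2) obtain p ts where atm: "atm L = Pred p ts"
    by (cases "atm L") auto
  have disj: "vars_clause C \<inter> vars_clause D = {}" if "D \<in> F - {C}" for D
    using assms(1) that by (auto simp: cnf_formula_def pairwise_def)
  have "satisfiable TYPE('d) (F \<union> {C})" if sat: "satisfiable TYPE('d) (F - {C})"
  proof -
    from sat obtain I :: "('f, 'p, 'd) interp" where I: "is_interp I"
      and I_F: "\<forall>D \<in> F - {C}. true_clause I D"
      by (auto simp: satisfiable_def)
    define J where "J = override I p (is_pos L)"
    \<comment> \<open>Nothing is asked of \<open>C\<close> here, so the empty set qualifies; the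
      truth of \<open>C\<close> comes from maximality.\<close>
    let ?\<A> = "{S. \<forall>D \<in> F - {C}. true_clause (J S) D}"
    have "\<exists>S \<in> ?\<A>. \<forall>T \<in> ?\<A>. S \<subseteq> T \<longrightarrow> T = S"
    proof (rule subset_Zorn_nonempty)
      have "{} \<in> ?\<A>" using I_F by (simp add: J_def)
      then show "?\<A> \<noteq> {}" by blast
    next
      fix \<S> assume \<S>: "\<S> \<noteq> {}" "subset.chain ?\<A> \<S>"
      then have "\<S> \<subseteq> ?\<A>" "subset.chain UNIV \<S>"
        by (auto simp: subset.chain_def)
      with \<S>(1) show "\<Union> \<S> \<in> ?\<A>"
        unfolding J_def by (auto intro!: true_clause_override_Union)
    qed
    then obtain S where "S \<in> ?\<A>" and max: "\<forall>T \<in> ?\<A>. S \<subseteq> T \<longrightarrow> T = S"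
      by (elim bexE)
    then have S: "\<forall>D \<in> F - {C}. true_clause (J S) D"
      by simp
    have "true_clause (J S) C"
    proof (rule ccontr)
      assume "\<not> true_clause (J S) C"
      then obtain \<beta> where \<beta>: "range \<beta> \<subseteq> domain (J S)"
        and C_false: "\<And>M. M \<in># C \<Longrightarrow> \<not> true_lit (J S) \<beta> M"
        unfolding true_clause_def by blast
      let ?ds = "map (eval_tm (J S) \<beta>) ts"
      have "true_clause (J (insert ?ds S)) D" if D: "D \<in> F - {C}" for D
      proof -
        have "is_interp (J S)" using I by (simp add: J_def)
        from true_clause_override_blocked[OF this _ disj[OF D] valid[OF D] L(1) atm \<beta> C_false]
        have "true_clause (override (J S) p (is_pos L) {?ds}) D"
          using S D by blast
        then show ?thesis by (simp only: J_def override_insert)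
      qed
      then have "insert ?ds S = S"
        by (intro max[rule_format]) auto
      then have "?ds \<in> S" by blast
      \<comment> \<open>On \<open>S\<close> the predicate \<open>p\<close> has the value
        \<open>is_pos L\<close>, which makes \<open>L\<close> true for either polarity.\<close>
      then have "true_lit (J S) \<beta> L"
        using atm by (cases L) (auto simp: J_def comp_def)
      with C_false L(1) show False by blast
    qed
    with S have "\<forall>D \<in> F \<union> {C}. true_clause (J S) D" by blast
    moreover have "is_interp (J S)" using I by (simp add: J_def)
    ultimately show ?thesis unfolding satisfiable_def by blast
  qed
  moreover have "satisfiable TYPE('d) (F - {C})" if "satisfiable TYPE('d) (F \<union> {C})"
    using that by (auto simp: satisfiable_def)
  ultimately show ?thesis
    by (auto simp: redundant_def sat_equivalent_def)
qed

end
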